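(* Let $p>3$ be a prime and let $k$ be an integer. Then the $\eta$-quotients of level $p$ lying in $M_k(\Gamma_1(p))$ are linearly independent over $\mathbb C$.
   Context: $\eta(z)=q^{1/24}\prod_{n\ge1}(1-q^n)$ with $q=e^{2\pi i z}$, for $z$ in the upper half plane. An $\eta$-quotient of level $p$ ($p$ prime) is a function $\eta(z)^{r_1}\eta(pz)^{r_p}$ with $r_1,r_p\in\mathbb Z$; its weight is $\frac12(r_1+r_p)$. $\Gamma_1(p)$ is the group of matrices in $\mathrm{SL}_2(\mathbb Z)$ congruent to $\begin{pmatrix}1&*\\0&1\end{pmatrix}$ modulo $p$, and $M_k(\Gamma_1(p))$ is the space of (holomorphic) modular forms of weight $k$ for $\Gamma_1(p)$. *)

theory Defs
  imports
    "HOL-Complex_Analysis.Complex_Analysis"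
    "HOL-Number_Theory.Cong"
    "HOL-Library.Function_Algebras"
begin

definition upper_half_plane :: "complex set" where
  "upper_half_plane = {z. Im z > 0}"

definition dedekind_eta :: "complex \<Rightarrow> complex" where
  "dedekind_eta z =
     exp (2 * of_real pi * \<i> * z / 24) *
     (\<Prod>n. 1 - exp (2 * of_real pi * \<i> * z) ^ Suc n)"

(* Functions on the upper half plane are represented by their extension by 0 to all complex
   numbers, so that equality of such functions is equality on the upper half plane. *)
definition eta_quotient :: "nat \<Rightarrow> int \<Rightarrow> int \<Rightarrow> complex \<Rightarrow> complex" where
  "eta_quotient p r\<^sub>1 r\<^sub>p z =
     (if z \<in> upper_half_plane
      then dedekind_eta z powi r\<^sub>1 * dedekind_eta (of_nat p * z) powi r\<^sub>p
      else 0)"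

definition eta_quotients :: "nat \<Rightarrow> (complex \<Rightarrow> complex) set" where
  "eta_quotients p = {eta_quotient p r\<^sub>1 r\<^sub>p | r\<^sub>1 r\<^sub>p. True}"

definition SL2Z :: "(int ^ 2 ^ 2) set" where
  "SL2Z = {A. det A = 1}"

definition Gamma1 :: "nat \<Rightarrow> (int ^ 2 ^ 2) set" where
  "Gamma1 N = {A \<in> SL2Z. [A $ 1 $ 1 = 1] (mod int N) \<and>
                         [A $ 2 $ 1 = 0] (mod int N) \<and>
                         [A $ 2 $ 2 = 1] (mod int N)}"

definition slash :: "int \<Rightarrow> int ^ 2 ^ 2 \<Rightarrow> (complex \<Rightarrow> complex) \<Rightarrow> complex \<Rightarrow> complex" where
  "slash k A f z =
     (of_int (A $ 2 $ 1) * z + of_int (A $ 2 $ 2)) powi (- k) *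
     f ((of_int (A $ 1 $ 1) * z + of_int (A $ 1 $ 2)) /
        (of_int (A $ 2 $ 1) * z + of_int (A $ 2 $ 2)))"

(* f is a holomorphic function of exp (2 pi i z / h), including at the point 0; equivalently,
   f has a Fourier expansion in that variable without negative exponents. *)
definition holomorphic_at_ii_inf :: "(complex \<Rightarrow> complex) \<Rightarrow> bool" where
  "holomorphic_at_ii_inf f \<longleftrightarrow>
     (\<exists>h::nat. h > 0 \<and> (\<exists>g. g holomorphic_on ball 0 1 \<and>
        (\<forall>z\<in>upper_half_plane. f z = g (exp (2 * of_real pi * \<i> * z / of_nat h)))))"

(* Meant for congruence subgroups G. Every cusp is the image of infinity under some element
   of SL2Z, so the last condition is holomorphy at all cusps. *)
definition modular_forms :: "int \<Rightarrow> (int ^ 2 ^ 2) set \<Rightarrow> (complex \<Rightarrow> complex) set" where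
  "modular_forms k G =
     {f. f holomorphic_on upper_half_plane \<and>
         (\<forall>z. z \<notin> upper_half_plane \<longrightarrow> f z = 0) \<and>
         (\<forall>A\<in>G. \<forall>z\<in>upper_half_plane. slash k A f z = f z) \<and>
         (\<forall>A\<in>SL2Z. holomorphic_at_ii_inf (slash k A f))}"

global_interpretation complex_fun:
  vector_space "\<lambda>(c::complex) (f::complex \<Rightarrow> complex) z. c * f z"
  by unfold_locales (auto simp: fun_eq_iff algebra_simps)

end

theory Submission
  imports Defs "HOL-Real_Asymp.Real_Asymp"
begin

text \<open>
  Transforming by \<open>z \<mapsto> -1/z\<close> shows that an eta-quotient \<open>f\<close> in \<open>M\<^sub>k\<close> satisfies
  \<open>ln \<bar>f(i/y)\<bar> = k ln y + c y + O(1)\<close> as \<open>y \<rightarrow> \<infinity>\<close>. On the other hand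
  \<open>ln \<eta>(it) = B/t - (ln t)/2 + O(1)\<close> as \<open>t \<rightarrow> 0\<close>, which is elementary (no inversion formula for
  \<open>\<eta>\<close> is needed) and forces \<open>r\<^sub>1 + r\<^sub>p = 2k\<close>. Given this, distinct quotients have distinct values of
  \<open>r\<^sub>1 + p r\<^sub>p\<close>, that is, distinct orders of decay at \<open>i\<infinity>\<close>, so they are independent.
\<close>

section \<open>The logarithm of the Euler product on the imaginary axis\<close>

text \<open>With q = e^(-s) and m counted from 1, the terms are q^m / (m (1 - q^m)): this is the
  Lambert series of -ln of the product of all 1 - q^n. Indexing by m rather than n exposes 1/(e^x -
  1) at x = s m, whose expansion near x = 0 controls the limit s -> 0.\<close>

definition eta_log_series :: "real \<Rightarrow> real" where
  "eta_log_series s = (\<Sum>m. 1 / (real (Suc m) * (exp (s * real (Suc m)) - 1)))"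

lemma inverse_exp_minus_one_le:
  fixes x :: real
  assumes "x > 0"
  shows "1 / (exp x - 1) \<le> 1 / x"
proof -
  have "x \<le> exp x - 1" using exp_ge_add_one_self[of x] by linarith
  then show ?thesis using assms by (intro divide_left_mono) auto
qed

text \<open>This is the start of the Laurent expansion 1/x - 1/2 + x/12 - ... with a generous error
  constant. Taylor's theorem and e^x <= 3 place e^x between 1 + x + x^2/2 and that sum plus 3/2 x^3;
  both bounds then follow by cross-multiplication. The constant -1/2 is the eventual source of the
  logarithmic term of ln eta.\<close>

lemma inverse_exp_minus_one_approx:
  fixes x :: real
  assumes "x > 0" "x \<le> 1"
  shows "\<bar>1 / (exp x - 1) - 1 / x + 1 / 2\<bar> \<le> 2 * x"
proof -
  have lo: "1 + x + x^2/2 \<le> exp x" using exp_lower_Taylor_quadratic[of x] assms by simp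
  have "(\<Sum>i\<le>2. x ^ i / fact i) = 1 + x + x^2/2" by (simp add: numeral_2_eq_2)
  moreover have "norm (exp x - (\<Sum>i\<le>2. x ^ i / fact i)) \<le> exp (norm x) * norm x ^ Suc 2 / fact 2"
    by (rule Taylor_exp_field)
  ultimately have "\<bar>exp x - (1 + x + x^2/2)\<bar> \<le> exp x * x^3 / 2"
    using assms by (simp add: numeral_3_eq_3)
  then have "exp x - (1 + x + x^2/2) \<le> exp x * x^3 / 2" by linarith
  moreover have "exp x * x^3 \<le> 3 * x^3"
    using exp_le exp_le_cancel_iff[of x 1] assms
    by (intro mult_right_mono) (auto simp del: exp_le_cancel_iff)
  ultimately have up: "exp x \<le> 1 + x + x^2/2 + 3/2 * x^3" by simp
  have pos: "exp x - 1 > 0" using assms by simp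
  have "1 / (exp x - 1) \<le> 1 / (x + x^2/2)"
    using lo assms by (intro divide_left_mono) (auto intro!: mult_pos_pos add_pos_pos)
  also have "\<dots> \<le> 1 / x - 1 / 2 + 2 * x"
  proof -
    have "1 \<le> (1 / x - 1 / 2 + 2 * x) * (x + x^2/2)"
    proof -
      have "(1 / x - 1 / 2 + 2 * x) * (x + x^2/2) = 1 + 7/4 * x^2 + x^3"
        using assms by (simp add: field_simps power2_eq_square power3_eq_cube)
      then show ?thesis using assms by simp
    qed
    then show ?thesis using assms by (subst pos_divide_le_eq) (auto intro!: add_pos_pos)
  qed
  finally have 1: "1 / (exp x - 1) \<le> 1 / x - 1 / 2 + 2 * x" .
  have "1 / x - 1 / 2 - 2 * x \<le> 1 / (x + x^2/2 + 3/2 * x^3)"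
  proof -
    have "(1 / x - 1 / 2 - 2 * x) * (x + x^2/2 + 3/2 * x^3) = 1 - (3/4 * x^2 + 7/4 * x^3 + 3 * x^4)"
      using assms by (simp add: field_simps power2_eq_square power3_eq_cube power4_eq_xxxx)
    then have "(1 / x - 1 / 2 - 2 * x) * (x + x^2/2 + 3/2 * x^3) \<le> 1"
      using assms zero_less_power[of x 2] zero_less_power[of x 3] zero_less_power[of x 4] by linarith
    then show ?thesis using assms by (subst pos_le_divide_eq) (auto intro!: add_pos_pos)
  qed
  also have "\<dots> \<le> 1 / (exp x - 1)"
    using up pos assms by (intro divide_left_mono) (auto intro!: mult_pos_pos add_pos_pos)
  finally show ?thesis using 1 by simp
qed

lemma summable_inverse_Suc_squares: "summable (\<lambda>m. 1 / real (Suc m) ^ 2)"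
  using summable_Suc_iff[of "\<lambda>m. inverse (real m ^ 2)"] inverse_power_summable[of 2, where 'a = real]
  by (simp only: inverse_eq_divide order_refl simp_thms)

lemma eta_log_term_bounds:
  fixes s :: real
  assumes "s > 0"
  shows "0 \<le> 1 / (real (Suc m) * (exp (s * real (Suc m)) - 1))"
    and "1 / (real (Suc m) * (exp (s * real (Suc m)) - 1)) \<le> (1 / s) * (1 / real (Suc m) ^ 2)"
proof -
  have pos: "s * real (Suc m) > 0" using assms by simp
  then show "0 \<le> 1 / (real (Suc m) * (exp (s * real (Suc m)) - 1))" by simp
  have "(1 / real (Suc m)) * (1 / (exp (s * real (Suc m)) - 1)) \<le> (1 / real (Suc m)) * (1 / (s * real (Suc m)))"
    by (intro mult_left_mono inverse_exp_minus_one_le pos) auto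
  then show "1 / (real (Suc m) * (exp (s * real (Suc m)) - 1)) \<le> (1 / s) * (1 / real (Suc m) ^ 2)"
    by (simp add: power2_eq_square mult_ac)
qed

lemma eta_log_series_sums:
  assumes "s > 0"
  shows "(\<lambda>m. 1 / (real (Suc m) * (exp (s * real (Suc m)) - 1))) sums eta_log_series s"
proof -
  have "summable (\<lambda>m. 1 / (real (Suc m) * (exp (s * real (Suc m)) - 1)))"
    by (rule summable_comparison_test'[OF summable_mult[OF summable_inverse_Suc_squares], of 0 _ "1/s"])
       (use eta_log_term_bounds[OF assms] in auto)
  then show ?thesis unfolding eta_log_series_def by (rule summable_sums)
qed

lemma eta_log_series_nonneg: "s > 0 \<Longrightarrow> eta_log_series s \<ge> 0"
  by (rule sums_le[OF eta_log_term_bounds(1) sums_zero eta_log_series_sums])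

text \<open>A crude rate, but enough to make the series vanish as s -> infinity, which is the
  behaviour at the cusp infinity.\<close>

lemma eta_log_series_le:
  assumes "s > 0"
  shows "eta_log_series s \<le> (\<Sum>m. 1 / real (Suc m) ^ 2) / s"
proof -
  have "(\<lambda>m. (1 / s) * (1 / real (Suc m) ^ 2)) sums ((1/s) * (\<Sum>m. 1 / real (Suc m) ^ 2))"
    by (intro sums_mult summable_sums summable_inverse_Suc_squares)
  from sums_le[OF eta_log_term_bounds(2)[OF assms] eta_log_series_sums[OF assms] this]
  show ?thesis by simp
qed

text \<open>Both sides sum the double series x^(m n) / m over m, n >= 1: the geometric series in n
  gives the terms of \<open>eta_log_series\<close>, and the logarithm series in m gives -ln (1 -
  x^n). Nonnegativity of the terms justifies the exchange.\<close>

lemma ln_euler_product_sums: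
  assumes "s > 0"
  shows "(\<lambda>n. - ln (1 - exp (- s) ^ Suc n)) sums eta_log_series s"
proof -
  define x where "x = exp (-s)"
  have x: "0 < x" "x < 1" using assms by (auto simp: x_def)
  define f where "f = (\<lambda>(m,n). (x ^ Suc m) ^ Suc n / real (Suc m))"
  define G where "G = (\<lambda>m. 1 / (real (Suc m) * (exp (s * real (Suc m)) - 1)))"
  have f_nonneg: "f mn \<ge> 0" for mn using x by (auto simp: f_def split: prod.splits)
  have col: "((\<lambda>n. f (m, n)) has_sum G m) UNIV" for m
  proof (rule sums_nonneg_imp_has_sum)
    define y where "y = x ^ Suc m"
    have y: "y < 1" "y > 0" using x power_Suc_less_one[of x m] by (auto simp: y_def)
    have "y = exp (- (s * real (Suc m)))"
      by (simp only: y_def x_def exp_of_nat2_mult[symmetric] mult_minus_left)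
    then have e: "exp (s * real (Suc m)) = 1 / y"
      by (metis exp_minus inverse_inverse_eq inverse_eq_divide)
    have "(\<lambda>n. (y / real (Suc m)) * y ^ n) sums ((y / real (Suc m)) * (1 / (1 - y)))"
      by (intro sums_mult geometric_sums) (use y in simp)
    moreover have "(y / c) * (1 / (1 - y)) = 1 / (c * (1 / y - 1))" if "c > 0" for c :: real
      using y that by (simp add: field_simps)
    then have "(y / real (Suc m)) * (1 / (1 - y)) = G m"
      unfolding G_def e by simp
    moreover have "f (m, n) = (y / real (Suc m)) * y ^ n" for n
      by (simp only: f_def prod.case y_def[symmetric] power_Suc[of y] times_divide_eq_left)
    ultimately show "(\<lambda>n. f (m, n)) sums G m" by simp
  qed (rule f_nonneg)
  have G: "(G has_sum eta_log_series s) UNIV"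
    unfolding G_def
    by (intro sums_nonneg_imp_has_sum eta_log_series_sums assms eta_log_term_bounds)
  have sm: "f summable_on UNIV \<times> UNIV"
    by (rule summable_on_SigmaI[where g = G]) (use col G f_nonneg in \<open>auto simp: summable_on_def\<close>)
  have "(f has_sum eta_log_series s) (UNIV \<times> UNIV)"
    by (rule has_sum_SigmaI[OF _ G sm]) (rule col)
  then have sw: "((\<lambda>(n,m). f (m,n)) has_sum eta_log_series s) (UNIV \<times> UNIV)"
    by (subst (asm) has_sum_swap) auto
  have row: "((\<lambda>m. (\<lambda>(n,m). f (m,n)) (n, m)) has_sum (- ln (1 - x ^ Suc n))) UNIV" for n
  proof (rule sums_nonneg_imp_has_sum)
    have xn: "x ^ Suc n < 1" "x ^ Suc n > 0" using x power_Suc_less_one[of x n] by auto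
    have "(\<lambda>m. - ((- (- (x ^ Suc n))) ^ m) / real m) sums ln (1 + - (x ^ Suc n))"
      using xn by (intro ln_series') simp
    from sums_minus[OF this] have "(\<lambda>m. (x ^ Suc n) ^ m / real m) sums - ln (1 - (x ^ Suc n))"
      by (simp del: power_Suc)
    \<comment> \<open>The term at m = 0 is a division by zero, hence 0, so starting at 1 leaves the
      sum unchanged.\<close>
    then have "(\<lambda>m. (x ^ Suc n) ^ Suc m / real (Suc m)) sums - ln (1 - (x ^ Suc n))"
      by (subst sums_Suc_iff) simp
    moreover have "(\<lambda>(n,m). f (m,n)) (n, m) = (x ^ Suc n) ^ Suc m / real (Suc m)" for m
      by (simp only: f_def prod.case power_mult[symmetric] mult.commute)
    ultimately show "(\<lambda>m. (\<lambda>(n,m). f (m,n)) (n, m)) sums (- ln (1 - x ^ Suc n))"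
      by (simp only:)
  qed (use f_nonneg in auto)
  have "((\<lambda>n. - ln (1 - x ^ Suc n)) has_sum eta_log_series s) UNIV"
    by (rule has_sum_SigmaD[OF sw row])
  then show ?thesis unfolding x_def by (rule has_sum_imp_sums)
qed

text \<open>At z = it the variable q is e^(-s) with s = 2 pi t, so every factor of the product is a
  real number in (0,1) and the product is the exponential of a sum of real logarithms.\<close>

lemma dedekind_eta_imaginary_axis:
  assumes "t > 0"
  shows "dedekind_eta (\<i> * of_real t) = of_real (exp (- (pi * t / 12) - eta_log_series (2 * pi * t)))"
proof -
  define s where "s = 2 * pi * t"
  have s: "s > 0" using assms by (simp add: s_def)
  have q: "exp (2 * of_real pi * \<i> * (\<i> * of_real t)) = complex_of_real (exp (-s))"
    by (simp add: s_def exp_of_real[symmetric] mult_ac)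
  have lt: "exp (- s) ^ Suc n < 1" for n using s power_Suc_less_one[of "exp (-s)" n] by simp
  have "(\<lambda>n. ln (1 - exp (- s) ^ Suc n)) sums (- eta_log_series s)"
    using sums_minus[OF ln_euler_product_sums[OF s]] by simp
  then have sums: "(\<lambda>n. complex_of_real (ln (1 - exp (- s) ^ Suc n))) sums of_real (- eta_log_series s)"
    by (rule sums_of_real)
  have "(\<Prod>n. 1 - complex_of_real (exp (-s)) ^ Suc n) =
          (\<Prod>n. exp (complex_of_real (ln (1 - exp (- s) ^ Suc n))))"
    using lt by (intro arg_cong[where f = prodinf] ext) (simp add: exp_of_real del: power_Suc)
  also have "\<dots> = exp (of_real (- eta_log_series s))"
    using prodinf_exp[OF sums_summable[OF sums]] sums_unique[OF sums] by simp
  finally have P: "(\<Prod>n. 1 - complex_of_real (exp (-s)) ^ Suc n) = of_real (exp (- eta_log_series s))"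
    by (simp only: exp_of_real)
  have E: "exp (2 * of_real pi * \<i> * (\<i> * of_real t) / 24) = complex_of_real (exp (- (pi * t / 12)))"
    by (simp add: exp_of_real[symmetric] mult_ac)
  show ?thesis
    unfolding dedekind_eta_def q P E of_real_mult[symmetric] exp_add[symmetric]
    by (simp only: s_def diff_conv_add_uminus)
qed

section \<open>Logarithmic asymptotics of eta near 0\<close>

text \<open>
  With \<open>N = \<lfloor>1/s\<rfloor>\<close>, comparing \<open>1/(e^x - 1)\<close> to \<open>1/x - 1/2\<close> in the terms \<open>m \<le> N\<close> and to
  \<open>1/x\<close> in the others shows that the series is \<open>A/s - H\<^sub>N/2 + O(1)\<close>.
\<close>
lemma eta_log_series_asymptotics:
  "\<exists>A C. \<forall>s. 0 < s \<and> s \<le> 1 \<longrightarrow> \<bar>eta_log_series s - A / s - ln s / 2\<bar> \<le> C"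
proof (intro exI allI impI)
  define A where "A = (\<Sum>m. 1 / real (Suc m) ^ 2)"
  fix s :: real
  assume "0 < s \<and> s \<le> 1"
  then have s: "0 < s" "s \<le> 1" by auto
  \<comment> \<open>Deviation of each term from its leading part 1/(s m^2), m counted from 1; these
    deviations add up to the series minus A/s.\<close>
  define d where "d = (\<lambda>m. 1 / (real (Suc m) * (exp (s * real (Suc m)) - 1)) - (1 / s) * (1 / real (Suc m) ^ 2))"
  define N where "N = nat \<lfloor>1 / s\<rfloor>"
  have N: "real N \<le> 1 / s" "1 / s < real N + 1"
    using s unfolding N_def by (auto simp: of_nat_nat)
  have "1 / s \<ge> 1" using s by simp
  then have "real N > 0" using N(2) by linarith
  then have N1: "N \<ge> 1" "real N \<ge> 1" by auto
  have "d sums (eta_log_series s - (1 / s) * A)"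
    unfolding d_def A_def
    by (intro sums_diff sums_mult eta_log_series_sums summable_sums summable_inverse_Suc_squares s)
  then have lim: "(\<lambda>M. \<bar>(\<Sum>m<M. d m) + harm N / 2\<bar>) \<longlonglongrightarrow> \<bar>eta_log_series s - (1 / s) * A + harm N / 2\<bar>"
    unfolding sums_def by (intro tendsto_intros)
  \<comment> \<open>The error 2x at x = s m, divided by m, is 2s for every m. Over N <= 1/s terms
    this totals at most 2.\<close>
  have head: "\<bar>d m + inverse (real (Suc m)) / 2\<bar> \<le> 2 * s" if "m < N" for m
  proof -
    have c: "real (Suc m) > 0" "real (Suc m) \<le> real N" using that by auto
    have "s * real (Suc m) \<le> s * (1 / s)" using c N s by (intro mult_left_mono) auto
    then have x: "s * real (Suc m) > 0" "s * real (Suc m) \<le> 1" using s c by simp_all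
    have "d m + inverse (real (Suc m)) / 2 =
        (1 / real (Suc m)) * (1 / (exp (s * real (Suc m)) - 1) - 1 / (s * real (Suc m)) + 1 / 2)"
      unfolding d_def by (simp add: algebra_simps power2_eq_square inverse_eq_divide del: of_nat_Suc)
    also have "\<bar>\<dots>\<bar> \<le> (1 / real (Suc m)) * (2 * (s * real (Suc m)))"
      unfolding abs_mult using inverse_exp_minus_one_approx[OF x] c
      by (intro mult_mono) auto
    also have "\<dots> = 2 * s" using c by (simp del: of_nat_Suc)
    finally show ?thesis .
  qed
  \<comment> \<open>Each term lies between 0 and its leading part, and 1/(m+1)^2 <= 1/m - 1/(m+1)
    telescopes. The sum is at most 1/(s N) <= (N+1)/N <= 2. The double minus gives the shape f (m+1)
    - f m.\<close>
  have tail: "\<bar>d m\<bar> \<le> (1 / s) * (- 1 / real (Suc m) - - 1 / real m)" if "N \<le> m" for m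
  proof -
    have m: "real m > 0" using that N1 by simp
    have "\<bar>d m\<bar> \<le> (1 / s) * (1 / real (Suc m) ^ 2)"
      using eta_log_term_bounds[OF s(1), of m] unfolding d_def by linarith
    also have "\<dots> \<le> (1 / s) * (- 1 / real (Suc m) - - 1 / real m)"
    proof (intro mult_left_mono)
      have "1 / real (Suc m) ^ 2 \<le> 1 / (real (Suc m) * real m)"
        unfolding power2_eq_square using m by (intro divide_left_mono mult_left_mono mult_pos_pos) auto
      also have "\<dots> = - 1 / real (Suc m) - - 1 / real m"
        using m by (simp add: field_simps)
      finally show "1 / real (Suc m) ^ 2 \<le> - 1 / real (Suc m) - - 1 / real m" .
    qed (use s in auto)
    finally show ?thesis .
  qed
  have bound: "\<bar>(\<Sum>m<M. d m) + harm N / 2\<bar> \<le> 4" if M: "N \<le> M" for M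
  proof -
    have "(\<Sum>m<M. d m) = (\<Sum>m<N. d m) + (\<Sum>m=N..<M. d m)"
      using sum.atLeastLessThan_concat[of 0 N M d] M by (simp add: lessThan_atLeast0)
    moreover have "(\<Sum>m<N. d m) + harm N / 2 = (\<Sum>m<N. d m + inverse (real (Suc m)) / 2)"
      by (simp only: sum.distrib harm_altdef sum_divide_distrib)
    moreover have "\<bar>\<Sum>m<N. d m + inverse (real (Suc m)) / 2\<bar> \<le> 2"
    proof -
      have "\<bar>\<Sum>m<N. d m + inverse (real (Suc m)) / 2\<bar> \<le> (\<Sum>m<N. 2 * s)"
        by (intro sum_abs[THEN order_trans] sum_mono head) auto
      also have "\<dots> = 2 * (real N * s)" by simp
      also have "\<dots> \<le> 2" using N(1) s by (simp add: field_simps)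
      finally show ?thesis .
    qed
    moreover have "\<bar>\<Sum>m=N..<M. d m\<bar> \<le> 2"
    proof -
      have "\<bar>\<Sum>m=N..<M. d m\<bar> \<le> (\<Sum>m=N..<M. (1 / s) * (- 1 / real (Suc m) - - 1 / real m))"
        by (intro sum_abs[THEN order_trans] sum_mono tail) auto
      also have "\<dots> = (1 / s) * (- 1 / real M - - 1 / real N)"
        unfolding sum_distrib_left[symmetric] using M sum_Suc_diff'[of N M "\<lambda>m. - 1 / real m"] by simp
      also have "\<dots> \<le> (real N + 1) * (1 / real N)"
      proof (rule mult_mono)
        have "1 / real M \<le> 1 / real N" using M N1 by (intro divide_left_mono) auto
        then show "0 \<le> - 1 / real M - - 1 / real N" by simp
      qed (use N(2) in auto)
      also have "\<dots> \<le> 2" using N1 by (simp add: field_simps)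
      finally show ?thesis .
    qed
    ultimately show ?thesis by linarith
  qed
  have main: "\<bar>eta_log_series s - (1 / s) * A + harm N / 2\<bar> \<le> 4"
    by (rule LIMSEQ_le_const2[OF lim]) (use bound in auto)
  \<comment> \<open>As N <= 1/s < N + 1, the harmonic number lies between -ln s and 1 - ln s, so
    -H_N/2 may be replaced by (ln s)/2 at bounded cost.\<close>
  have "harm N - ln (real N) \<le> harm 1 - ln (real 1)"
    by (rule euler_mascheroni_sequence_decreasing) (use N1 in auto)
  then have h1: "harm N \<le> 1 + ln (real N)" by (simp add: harm_def)
  have "ln (real N) \<le> ln (1 / s)" using N N1 s by (subst ln_le_cancel_iff) auto
  then have h2: "ln (real N) \<le> - ln s" using s by (simp add: ln_div)
  have "ln (1 / s) \<le> ln (real N + 1)" using N N1 s by (subst ln_le_cancel_iff) auto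
  then have h3: "- ln s \<le> harm N" using s ln_le_harm[of N] by (simp add: ln_div)
  have "\<bar>harm N / 2 + ln s / 2\<bar> \<le> 1" using h1 h2 h3 by linarith
  then show "\<bar>eta_log_series s - A / s - ln s / 2\<bar> \<le> 5" using main by simp
qed

text \<open>The real logarithm of eta(it) for t > 0.\<close>

definition ln_eta :: "real \<Rightarrow> real" where
  "ln_eta t = - (pi * t / 12) - eta_log_series (2 * pi * t)"

text \<open>Substituting s = 2 pi t leaves only bounded extra terms, pi t/12 and ln(2 pi)/2; the
  range of t is exactly s <= 1.\<close>

lemma ln_eta_asymptotics_at_0:
  "\<exists>B C. \<forall>t. 0 < t \<and> t \<le> 1 / (2 * pi) \<longrightarrow> \<bar>ln_eta t - B / t + ln t / 2\<bar> \<le> C"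
proof -
  obtain A C where AC: "\<And>s. 0 < s \<Longrightarrow> s \<le> 1 \<Longrightarrow> \<bar>eta_log_series s - A / s - ln s / 2\<bar> \<le> C"
    using eta_log_series_asymptotics by blast
  have "\<bar>ln_eta t - (- A / (2 * pi)) / t + ln t / 2\<bar> \<le> C + 1 + \<bar>ln (2 * pi)\<bar>"
    if t: "0 < t" "t \<le> 1 / (2 * pi)" for t
  proof -
    have s: "2 * pi * t > 0" "2 * pi * t \<le> 1" using t by (auto simp: field_simps)
    have "\<bar>eta_log_series (2 * pi * t) - A / (2 * pi * t) - ln (2 * pi * t) / 2\<bar> \<le> C"
      by (rule AC[OF s])
    moreover have "ln (2 * pi * t) = ln (2 * pi) + ln t" using t by (subst ln_mult) auto
    moreover have "0 \<le> pi * t / 12" "pi * t / 12 \<le> 1" using s by auto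
    moreover have "(- A / (2 * pi)) / t = - (A / (2 * pi * t))" by simp
    ultimately show ?thesis unfolding ln_eta_def by argo
  qed
  then show ?thesis by blast
qed

section \<open>Eta-quotients near the cusp 0\<close>

lemma eta_quotient_imaginary_axis:
  assumes "t > 0" "p > 0"
  shows "eta_quotient p r1 rp (\<i> * of_real t) =
           of_real (exp (of_int r1 * ln_eta t + of_int rp * ln_eta (real p * t)))"
proof -
  have pt: "of_nat p * (\<i> * complex_of_real t) = \<i> * of_real (real p * t)" by simp
  have 1: "dedekind_eta (of_nat p * (\<i> * of_real t)) = of_real (exp (ln_eta (real p * t)))"
    unfolding pt ln_eta_def by (rule dedekind_eta_imaginary_axis) (use assms in simp)
  have 2: "dedekind_eta (\<i> * of_real t) = of_real (exp (ln_eta t))"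
    unfolding ln_eta_def by (rule dedekind_eta_imaginary_axis) (use assms in simp)
  have 3: "exp x powi m = exp (of_int m * x)" for x :: real and m
    by (simp add: exp_power_int mult.commute)
  show ?thesis
    using assms by (simp only: eta_quotient_def 1 2 of_real_power_int[symmetric] 3)
       (simp add: upper_half_plane_def exp_add)
qed

text \<open>Each eta factor contributes (ln y)/2 per exponent, since replacing t by p t changes ln t
  only by a constant. The threshold on y puts both 1/y and p/y into the range of
  \<open>ln_eta_asymptotics_at_0\<close>.\<close>

lemma eta_quotient_asymptotics_at_cusp_0:
  assumes "p > 0"
  shows "\<exists>b C. \<forall>y \<ge> 2 * pi * real p.
    \<bar>of_int r1 * ln_eta (1 / y) + of_int rp * ln_eta (real p * (1 / y)) - b * y - of_int (r1 + rp) / 2 * ln y\<bar> \<le> C"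
proof -
  obtain B C where BC: "\<And>t. 0 < t \<Longrightarrow> t \<le> 1 / (2 * pi) \<Longrightarrow> \<bar>ln_eta t - B / t + ln t / 2\<bar> \<le> C"
    using ln_eta_asymptotics_at_0 by blast
  define b where "b = of_int r1 * B + of_int rp * B / real p"
  have "\<bar>of_int r1 * ln_eta (1 / y) + of_int rp * ln_eta (real p * (1 / y)) - b * y - of_int (r1 + rp) / 2 * ln y\<bar>
          \<le> \<bar>of_int r1\<bar> * C + \<bar>of_int rp\<bar> * C + \<bar>of_int rp * (ln (real p) / 2)\<bar>"
    if y: "y \<ge> 2 * pi * real p" for y
  proof -
    have "2 * pi * real p \<ge> 2 * pi" "2 * pi * real p > 0" using assms by auto
    then have y': "y > 0" "y \<ge> 2 * pi" using y by linarith+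
    define e1 where "e1 = ln_eta (1 / y) - B / (1 / y) + ln (1 / y) / 2"
    define e2 where "e2 = ln_eta (real p * (1 / y)) - B / (real p * (1 / y)) + ln (real p * (1 / y)) / 2"
    have "\<bar>e1\<bar> \<le> C" unfolding e1_def by (rule BC) (use y' in \<open>auto simp: field_simps\<close>)
    moreover have "\<bar>e2\<bar> \<le> C" unfolding e2_def by (rule BC) (use y y' assms in \<open>auto simp: field_simps\<close>)
    ultimately have e: "\<bar>of_int r1 * e1\<bar> \<le> \<bar>of_int r1\<bar> * C" "\<bar>of_int rp * e2\<bar> \<le> \<bar>of_int rp\<bar> * C"
      unfolding abs_mult by (auto intro: mult_left_mono)
    have "ln (real p * (1 / y)) = ln (real p) - ln y" "ln (1 / y) = - ln y"
      using assms y' by (simp_all add: ln_div)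
    then have l: "ln_eta (1 / y) = e1 + B * y + ln y / 2"
      "ln_eta (real p * (1 / y)) = e2 + B / real p * y - ln (real p) / 2 + ln y / 2"
      unfolding e1_def e2_def by (auto simp: field_simps)
    have "of_int r1 * ln_eta (1 / y) + of_int rp * ln_eta (real p * (1 / y)) - b * y - of_int (r1 + rp) / 2 * ln y
      = of_int r1 * e1 + of_int rp * e2 - of_int rp * (ln (real p) / 2)"
      unfolding l by (simp add: b_def algebra_simps add_divide_distrib)
    then show ?thesis using e by linarith
  qed
  then show ?thesis by blast
qed

section \<open>Growth at the cusp 0 determines the weight\<close>

text \<open>Division by y and y -> infinity gives a = 0; division by ln y then gives b = 0.\<close>

lemma bounded_linear_plus_ln_imp_zero:
  fixes a b C Y :: real
  assumes "\<And>y. y \<ge> Y \<Longrightarrow> \<bar>a * y + b * ln y\<bar> \<le> C"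
  shows "b = 0"
proof -
  have "((\<lambda>y. (a * y + b * ln y) / y) \<longlongrightarrow> 0) at_top"
  proof (rule Lim_null_comparison)
    show "\<forall>\<^sub>F y in at_top. norm ((a * y + b * ln y) / y) \<le> C / y"
      using eventually_ge_at_top[of Y] eventually_gt_at_top[of 0]
      by eventually_elim (use assms in \<open>simp add: divide_right_mono\<close>)
    show "((\<lambda>y. C / y) \<longlongrightarrow> 0) at_top" by real_asymp
  qed
  moreover have "((\<lambda>y. (a * y + b * ln y) / y) \<longlongrightarrow> a) at_top" by real_asymp
  ultimately have a: "a = 0" using tendsto_unique[OF _ _ ] by (metis trivial_limit_at_top_linorder)
  have "((\<lambda>y. (b * ln y) / ln y) \<longlongrightarrow> 0) at_top"
  proof (rule Lim_null_comparison)
    show "\<forall>\<^sub>F y in at_top. norm ((b * ln y) / ln y) \<le> C / ln y"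
      using eventually_ge_at_top[of Y] eventually_gt_at_top[of 1]
    proof eventually_elim
      case (elim y)
      then have "\<bar>b * ln y\<bar> \<le> C" "ln y > 0" using assms[of y] a by auto
      then show ?case
        unfolding real_norm_def abs_divide abs_of_pos[OF \<open>ln y > 0\<close>]
        by (intro divide_right_mono) auto
    qed
    show "((\<lambda>y. C / ln y) \<longlongrightarrow> 0) at_top" by real_asymp
  qed
  moreover have "((\<lambda>y. (b * ln y) / ln y) \<longlongrightarrow> b) at_top" by real_asymp
  ultimately show ?thesis by (metis tendsto_unique trivial_limit_at_top_linorder)
qed

text \<open>Near 0 the function g factors as w^n u(w) with u zero-free, and w = e^(-2 pi y/h) on the
  imaginary axis, so ln |f(iy)| is -(2 pi n/h) y + O(1), without a ln y term. The value at
  \<open>y0\<close> rules out g = 0.\<close>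

lemma holomorphic_at_ii_inf_asymptotics:
  assumes f: "holomorphic_at_ii_inf f" and nz: "f (\<i> * of_real y0) \<noteq> 0" "y0 > 0"
  shows "\<exists>c C Y. \<forall>y\<ge>Y. y > 0 \<and> \<bar>ln (norm (f (\<i> * of_real y))) - c * y\<bar> \<le> C"
proof -
  obtain h :: nat and g where h: "h > 0" and g: "g holomorphic_on ball 0 1"
    and fg: "\<And>z. z \<in> upper_half_plane \<Longrightarrow> f z = g (exp (2 * of_real pi * \<i> * z / of_nat h))"
    using f unfolding holomorphic_at_ii_inf_def by blast
  define w where "w = (\<lambda>y. exp (- (2 * pi * y / real h)))"
  have fw: "f (\<i> * of_real y) = g (of_real (w y))" if "y > 0" for y
  proof -
    have "2 * of_real pi * \<i> * (\<i> * of_real y) / of_nat h = complex_of_real (- (2 * pi * y / real h))"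
      by (simp add: mult.assoc)
    then show ?thesis
      using fg[of "\<i> * of_real y"] that
      by (simp only: w_def exp_of_real) (simp add: upper_half_plane_def)
  qed
  have w: "0 < w y" "w y < 1" if "y > 0" for y using that h by (auto simp: w_def)
  have nonconst: "\<exists>z\<in>ball 0 1. g z \<noteq> 0"
    using fw[OF nz(2)] nz w[OF nz(2)] by (intro bexI[of _ "of_real (w y0)"]) auto
  have "(0::complex) \<in> ball 0 1" by simp
  from zorder_exist_zero[OF g open_ball connected_ball this nonconst, THEN conjunct2]
  obtain r where r: "r > 0" "zor_poly g 0 holomorphic_on cball 0 r"
    "\<forall>z\<in>cball 0 r. g z = zor_poly g 0 z * (z - 0) ^ nat (zorder g 0) \<and> zor_poly g 0 z \<noteq> 0"
    by blast
  define u where "u = zor_poly g 0"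
  define n where "n = nat (zorder g 0)"
  have gu: "g z = u z * z ^ n" "u z \<noteq> 0" if "z \<in> cball 0 r" for z
    using r(3) that by (simp_all add: u_def n_def)
  have "continuous_on (cball 0 r) (\<lambda>z. ln (norm (u z)))"
    using holomorphic_on_imp_continuous_on[OF r(2)] gu(2) unfolding u_def[symmetric]
    by (intro continuous_intros) auto
  then have "bounded ((\<lambda>z. ln (norm (u z))) ` cball 0 r)"
    by (intro compact_imp_bounded compact_continuous_image compact_cball)
  then have "\<exists>C. \<forall>z\<in>cball 0 r. \<bar>ln (norm (u z))\<bar> \<le> C"
    by (simp add: bounded_iff)
  then obtain C where C: "\<And>z. z \<in> cball 0 r \<Longrightarrow> \<bar>ln (norm (u z))\<bar> \<le> C"
    by blast
  \<comment> \<open>The second bound in the maximum is equivalent to \<open>w y\<close> <= r, so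
    that the factorization applies.\<close>
  have "y > 0 \<and> \<bar>ln (norm (f (\<i> * of_real y))) - (- (real n * (2 * pi / real h))) * y\<bar> \<le> C"
    if y: "y \<ge> max 1 (- ln r * real h / (2 * pi))" for y
  proof -
    have y0: "y > 0" using y by simp
    have "- ln r * real h / (2 * pi) \<le> y" using y by simp
    then have "- ln r * real h \<le> y * (2 * pi)" by (subst (asm) pos_divide_le_eq) simp_all
    then have "- (2 * pi * y / real h) \<le> ln r" using h by (simp add: field_simps)
    then have "w y \<le> exp (ln r)" unfolding w_def by (simp only: exp_le_cancel_iff)
    then have wr: "of_real (w y) \<in> cball (0::complex) r" using r(1) w[OF y0] by simp
    have "ln (norm (f (\<i> * of_real y))) = ln (norm (u (of_real (w y)))) + real n * ln (w y)"
      using gu[OF wr] w[OF y0] by (simp add: fw[OF y0] norm_mult norm_power ln_mult ln_realpow)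
    also have "ln (w y) = - (2 * pi * y / real h)" by (simp add: w_def)
    finally show ?thesis using C[OF wr] y0 by simp
  qed
  then show ?thesis by blast
qed

text \<open>For the transform under z -> -1/z, holomorphy at infinity gives ln |.| = c y + O(1),
  while the eta asymptotics give b y + ((r1 + rp)/2 - k) ln y + O(1). The coefficient of ln y must
  therefore vanish, whatever b and c are.\<close>

lemma eta_quotient_weight:
  assumes "eta_quotient p r1 rp \<in> modular_forms k G" and p: "p > 0"
  shows "r1 + rp = 2 * k"
proof -
  \<comment> \<open>This matrix sends iy to i/y, and its automorphy factor has absolute value y^(-k)
    at iy.\<close>
  define S :: "int^2^2" where "S = vector [vector [0, -1], vector [1, 0]]"
  have "S \<in> SL2Z" by (simp add: SL2Z_def S_def det_2)
  then have hol: "holomorphic_at_ii_inf (slash k S (eta_quotient p r1 rp))"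
    using assms(1) by (simp add: modular_forms_def)
  define L where "L = (\<lambda>y. of_int r1 * ln_eta (1 / y) + of_int rp * ln_eta (real p * (1 / y)))"
  have val: "norm (slash k S (eta_quotient p r1 rp) (\<i> * of_real y)) = y powi (- k) * exp (L y)"
    if y: "y > 0" for y
  proof -
    have inv: "- (1 / (\<i> * complex_of_real y)) = \<i> / of_real y" using y by (simp add: field_simps)
    have "slash k S (eta_quotient p r1 rp) (\<i> * of_real y) =
        (\<i> * of_real y) powi (- k) * eta_quotient p r1 rp (\<i> * of_real (1 / y))"
      by (simp add: slash_def S_def inv)
    also have "eta_quotient p r1 rp (\<i> * of_real (1 / y)) = of_real (exp (L y))"
      unfolding L_def by (rule eta_quotient_imaginary_axis) (use y p in auto)
    finally show ?thesis using y by (simp only: norm_mult norm_power_int norm_of_real) simp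
  qed
  have "slash k S (eta_quotient p r1 rp) (\<i> * of_real 1) \<noteq> 0"
    using val[of 1] by force
  from holomorphic_at_ii_inf_asymptotics[OF hol this] obtain c C Y where
    Y: "\<And>y. y \<ge> Y \<Longrightarrow> y > 0"
    and C: "\<And>y. y \<ge> Y \<Longrightarrow> \<bar>ln (norm (slash k S (eta_quotient p r1 rp) (\<i> * of_real y))) - c * y\<bar> \<le> C"
    by auto
  obtain b D where D: "\<And>y. y \<ge> 2 * pi * real p \<Longrightarrow> \<bar>L y - b * y - of_int (r1 + rp) / 2 * ln y\<bar> \<le> D"
    using eta_quotient_asymptotics_at_cusp_0[OF p] unfolding L_def by blast
  have "of_int (r1 + rp) / 2 - real_of_int k = 0"
  proof (rule bounded_linear_plus_ln_imp_zero)
    fix y assume y: "y \<ge> max Y (2 * pi * real p)"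
    then have y0: "y > 0" using Y by simp
    have "ln (norm (slash k S (eta_quotient p r1 rp) (\<i> * of_real y))) = L y - of_int k * ln y"
      using y0 by (simp add: val ln_mult powr_real_of_int'[symmetric] ln_powr)
    then have "\<bar>(L y - of_int k * ln y) - c * y\<bar> \<le> C" using C[of y] y by simp
    moreover have "\<bar>L y - b * y - of_int (r1 + rp) / 2 * ln y\<bar> \<le> D" using D y by simp
    moreover have "(b - c) * y + (of_int (r1 + rp) / 2 - real_of_int k) * ln y =
      ((L y - of_int k * ln y) - c * y) - (L y - b * y - of_int (r1 + rp) / 2 * ln y)"
      by (simp add: algebra_simps)
    ultimately show "\<bar>(b - c) * y + (of_int (r1 + rp) / 2 - real_of_int k) * ln y\<bar> \<le> C + D"
      by linarith
  qed
  then have "real_of_int (r1 + rp) = real_of_int (2 * k)" by simp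
  then show ?thesis by (simp only: of_int_eq_iff)
qed

section \<open>Exact order of decay at infinity\<close>

lemma ln_eta_asymptotics_at_infinity:
  "((\<lambda>t. ln_eta t + pi * t / 12) \<longlongrightarrow> 0) at_top"
proof (rule Lim_null_comparison)
  define A where "A = (\<Sum>m. 1 / real (Suc m) ^ 2)"
  show "\<forall>\<^sub>F t in at_top. norm (ln_eta t + pi * t / 12) \<le> A / (2 * pi * t)"
    using eventually_gt_at_top[of 0]
  proof eventually_elim
    case (elim t)
    then show ?case
      using eta_log_series_nonneg[of "2 * pi * t"] eta_log_series_le[of "2 * pi * t"]
      by (simp add: ln_eta_def A_def)
  qed
  show "((\<lambda>t. A / (2 * pi * t)) \<longlongrightarrow> 0) at_top" by real_asymp
qed

text \<open>The leading power of q is (r1 + p rp)/24, and q = e^(-2 pi t) at z = it; the exponential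
  factor cancels exactly this power.\<close>

lemma eta_quotient_asymptotics_at_infinity:
  fixes r1 rp :: int
  assumes p: "p > 0"
  shows "((\<lambda>t. eta_quotient p r1 rp (\<i> * of_real t) *
            of_real (exp (pi * t / 12 * of_int (r1 + int p * rp)))) \<longlongrightarrow> 1) at_top"
proof -
  have pt: "filterlim (\<lambda>t. real p * t) at_top at_top"
    using p by real_asymp
  have "((\<lambda>t. exp (of_int r1 * (ln_eta t + pi * t / 12) +
               of_int rp * (ln_eta (real p * t) + pi * (real p * t) / 12))) \<longlongrightarrow>
          exp (of_int r1 * 0 + of_int rp * 0)) at_top"
    by (intro tendsto_intros ln_eta_asymptotics_at_infinity
          filterlim_compose[OF ln_eta_asymptotics_at_infinity pt])
  then have "((\<lambda>t. complex_of_real (exp (of_int r1 * (ln_eta t + pi * t / 12) +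
               of_int rp * (ln_eta (real p * t) + pi * (real p * t) / 12)))) \<longlongrightarrow> of_real 1) at_top"
    by (intro tendsto_of_real) simp
  moreover have "\<forall>\<^sub>F t in at_top. complex_of_real (exp (of_int r1 * (ln_eta t + pi * t / 12) +
               of_int rp * (ln_eta (real p * t) + pi * (real p * t) / 12))) =
      eta_quotient p r1 rp (\<i> * of_real t) * of_real (exp (pi * t / 12 * of_int (r1 + int p * rp)))"
    using eventually_gt_at_top[of 0]
  proof eventually_elim
    case (elim t)
    show ?case
      unfolding eta_quotient_imaginary_axis[OF elim p] of_real_mult[symmetric] exp_add[symmetric]
      by (simp add: algebra_simps add_divide_distrib)
  qed
  ultimately show ?thesis by (simp add: tendsto_cong)
qed

section \<open>Linear independence from distinct orders at infinity\<close>

theorem theorem5p5: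
  fixes p :: nat and k :: int
  assumes "prime p" and "p > 3"
  shows "complex_fun.independent (eta_quotients p \<inter> modular_forms k (Gamma1 p))"
proof
  assume "complex_fun.dependent (eta_quotients p \<inter> modular_forms k (Gamma1 p))"
  then obtain T u where T: "finite T" "T \<subseteq> eta_quotients p \<inter> modular_forms k (Gamma1 p)"
    and zero: "(\<Sum>v\<in>T. (\<lambda>z. u v * v z)) = 0" and ne: "\<exists>v\<in>T. u v \<noteq> 0"
    unfolding complex_fun.dependent_explicit by blast
  have p: "p > 0" using assms by simp
  have "\<forall>v\<in>T. \<exists>r1 rp. v = eta_quotient p r1 rp"
    using T(2) by (auto simp: eta_quotients_def)
  then obtain r1 rp where rep: "\<And>v. v \<in> T \<Longrightarrow> v = eta_quotient p (r1 v) (rp v)"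
    by metis
  have weight: "r1 v + rp v = 2 * k" if "v \<in> T" for v
    using eta_quotient_weight[of p "r1 v" "rp v" k "Gamma1 p"] rep[OF that] T(2) that p by auto
  \<comment> \<open>24 times the order in q at infinity.\<close>
  define e where "e = (\<lambda>v. r1 v + int p * rp v)"
  have e_inj: "v = w" if vw: "v \<in> T" "w \<in> T" "e v = e w" for v w
  proof -
    \<comment> \<open>Subtracting the common sum 2k from \<open>e\<close> leaves (p - 1) rp, so
      equal orders force equal exponents.\<close>
    have "(int p - 1) * (rp v - rp w) = (e v - (r1 v + rp v)) - (e w - (r1 w + rp w))"
      by (simp add: e_def algebra_simps)
    also have "\<dots> = 0" using vw weight by simp
    finally have "rp v = rp w" using assms(2) by simp
    moreover from this have "r1 v = r1 w" using weight vw by (metis add_right_imp_eq)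
    ultimately show ?thesis using rep vw by metis
  qed
  \<comment> \<open>Dropping zero coefficients ensures that the quotient of least order,
    \<open>v0\<close>, carries a nonzero one.\<close>
  define T' where "T' = {v \<in> T. u v \<noteq> 0}"
  have T': "finite T'" "T' \<noteq> {}" using T ne by (auto simp: T'_def)
  define v0 where "v0 = arg_min_on e T'"
  have v0: "v0 \<in> T'" "\<And>v. v \<in> T' \<Longrightarrow> e v0 \<le> e v"
    using arg_min_if_finite[OF T', of e] unfolding v0_def by (auto simp: not_less)
  have sum_apply: "(\<Sum>v\<in>A. (\<lambda>z. u v * v z)) x = (\<Sum>v\<in>A. u v * v x)" if "finite A" for A x
    using that by (induction A rule: finite_induct) auto
  \<comment> \<open>Normalization by the slowest decay: \<open>v0\<close> times \<open>E\<close>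
    tends to 1, and every other quotient in \<open>T'\<close> times \<open>E\<close> tends to
    0.\<close>
  define E where "E = (\<lambda>t::real. complex_of_real (exp (pi * t / 12 * of_int (e v0))))"
  have lim: "((\<lambda>t. v (\<i> * of_real t) * E t) \<longlongrightarrow> (if v = v0 then 1 else 0)) at_top" if v: "v \<in> T'" for v
  proof -
    have "((\<lambda>t. v (\<i> * of_real t) * of_real (exp (pi * t / 12 * of_int (e v)))) \<longlongrightarrow> 1) at_top"
      using eta_quotient_asymptotics_at_infinity[OF p, of "r1 v" "rp v"] rep v
      by (simp add: T'_def e_def)
    moreover have "((\<lambda>t. complex_of_real (exp (pi * t / 12 * - of_int (e v - e v0)))) \<longlongrightarrow>
                      of_real (if v = v0 then 1 else 0)) at_top"
    proof (cases "v = v0")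
      case False
      then have "e v \<noteq> e v0" using e_inj v v0(1) by (auto simp: T'_def)
      then have "e v - e v0 > 0" using v0(2)[OF v] by simp
      then have "real_of_int (e v - e v0) > 0" by (simp only: of_int_0_less_iff)
      moreover have "((\<lambda>t. exp (pi * t / 12 * - d)) \<longlongrightarrow> 0) at_top" if "d > 0" for d :: real
        using that by real_asymp
      ultimately have "((\<lambda>t. exp (pi * t / 12 * - of_int (e v - e v0))) \<longlongrightarrow> (0::real)) at_top"
        by blast
      then show ?thesis using False by (intro tendsto_of_real) simp
    qed simp
    ultimately have "((\<lambda>t. v (\<i> * of_real t) * of_real (exp (pi * t / 12 * of_int (e v))) *
        complex_of_real (exp (pi * t / 12 * - of_int (e v - e v0)))) \<longlongrightarrow>
        1 * of_real (if v = v0 then 1 else 0)) at_top"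
      by (rule tendsto_mult)
    moreover have "v (\<i> * of_real t) * of_real (exp (pi * t / 12 * of_int (e v))) *
        complex_of_real (exp (pi * t / 12 * - of_int (e v - e v0))) = v (\<i> * of_real t) * E t" for t
      unfolding E_def mult.assoc of_real_mult[symmetric] exp_add[symmetric]
      by (simp add: algebra_simps diff_divide_distrib)
    ultimately show ?thesis by (simp only:) (simp split: if_splits)
  qed
  \<comment> \<open>The rescaled relation is identically 0 but tends to \<open>u v0\<close>, which
    contradicts the choice of \<open>v0\<close>.\<close>
  have "((\<lambda>t. \<Sum>v\<in>T'. u v * (v (\<i> * of_real t) * E t)) \<longlongrightarrow> (\<Sum>v\<in>T'. u v * (if v = v0 then 1 else 0))) at_top"
    by (intro tendsto_intros lim)
  also have "(\<Sum>v\<in>T'. u v * (if v = v0 then 1 else 0)) = u v0"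
  proof -
    have "(\<Sum>v\<in>T'. u v * (if v = v0 then 1 else 0)) = (\<Sum>v\<in>T'. if v = v0 then u v else 0)"
      by (intro sum.cong) auto
    also have "\<dots> = u v0" using T' v0(1) by (subst sum.delta) auto
    finally show ?thesis .
  qed
  also have "(\<lambda>t. \<Sum>v\<in>T'. u v * (v (\<i> * of_real t) * E t)) = (\<lambda>t. 0)"
  proof
    fix t
    have "(\<Sum>v\<in>T'. u v * v (\<i> * of_real t)) = (\<Sum>v\<in>T. u v * v (\<i> * of_real t))"
      using T(1) by (intro sum.mono_neutral_left) (auto simp: T'_def)
    also have "\<dots> = 0"
      using sum_apply[OF T(1), of "\<i> * of_real t"] zero by simp
    finally show "(\<Sum>v\<in>T'. u v * (v (\<i> * of_real t) * E t)) = 0"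
      by (simp add: mult.assoc[symmetric] sum_distrib_right[symmetric])
  qed
  finally have "u v0 = 0" by (simp add: tendsto_const_iff)
  then show False using v0(1) by (simp add: T'_def)
qed

end
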